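(* Let $X$ be a median graph. Then $$\mathcal{R}_+(\mathcal{T}_\infty)\subset\mathcal{R}_+(X).$$
   Context: $\mathbb{N}=\{0,1,2,\dots\}$. $\mathcal{T}_\infty$ is the homogeneous tree of (countably) infinite degree. A graph is identified with its vertex set, and $d$ is the edge-path distance. A function $\psi:X\times X\to\mathbb{C}$ is positive definite if $\sum_{i,j=1}^n\psi(x_i,x_j)\overline{z_i}z_j\ge 0$ for all finite families $x_1,\dots,x_n\in X$ and $z_1,\dots,z_n\in\mathbb{C}$. For a connected graph $X$, $\mathcal{R}_+(X)$ is the set of functions $\varphi:\mathbb{N}\to\mathbb{C}$ such that $(x,y)\mapsto\varphi(d(x,y))$ is positive definite on $X$. A connected graph $X$ is median if $|I(x,y)\cap I(y,z)\cap I(z,x)|=1$ for all $x,y,z\in X$, where $I(x,y)=\{u\in X: d(x,y)=d(x,u)+d(u,y)\}$. *)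

theory Defs
  imports
    "HOL-Library.Complex_Order"
    "HOL-Library.Countable_Set"
    "Graph_Theory.Graph_Theory"
begin

text \<open>
  An undirected simple graph, of arbitrary cardinality, is a
  \<^locale>\<open>pair_bidirected_digraph\<close>: a vertex set together with a symmetric,
  irreflexive set of ordered pairs of vertices. The constant
  \<^const>\<open>Digraph_Component.connected\<close> requires at least one vertex.
\<close>

definition connected_graph :: "'a pair_pre_digraph \<Rightarrow> bool" where
  "connected_graph X \<longleftrightarrow>
    pair_bidirected_digraph X \<and> Digraph_Component.connected (with_proj X)"

text \<open>Only meaningful for vertices that are joined by a walk.\<close>

definition graph_dist :: "'a pair_pre_digraph \<Rightarrow> 'a \<Rightarrow> 'a \<Rightarrow> nat" where
  "graph_dist X x y =
    (LEAST n. \<exists>p. pre_digraph.awalk (with_proj X) x p y \<and> length p = n)"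

definition interval :: "'a pair_pre_digraph \<Rightarrow> 'a \<Rightarrow> 'a \<Rightarrow> 'a set" where
  "interval X x y =
    {u \<in> pverts X. graph_dist X x y = graph_dist X x u + graph_dist X u y}"

definition median_graph :: "'a pair_pre_digraph \<Rightarrow> bool" where
  "median_graph X \<longleftrightarrow> connected_graph X \<and>
    (\<forall>x\<in>pverts X. \<forall>y\<in>pverts X. \<forall>z\<in>pverts X.
      card (interval X x y \<inter> interval X y z \<inter> interval X z x) = 1)"

text \<open>
  The order on the complex numbers is the one of Complex_Order, so that
  \<^prop>\<open>0 \<le> (w::complex)\<close> says that \<^term>\<open>w\<close> is real and nonnegative.
  The points of a family need not be distinct.
\<close>

definition positive_definite_on :: "'a set \<Rightarrow> ('a \<Rightarrow> 'a \<Rightarrow> complex) \<Rightarrow> bool" where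
  "positive_definite_on S \<psi> \<longleftrightarrow>
    (\<forall>(n::nat) (x::nat \<Rightarrow> 'a) (z::nat \<Rightarrow> complex). (\<forall>i<n. x i \<in> S) \<longrightarrow>
      0 \<le> (\<Sum>i<n. \<Sum>j<n. \<psi> (x i) (x j) * cnj (z i) * z j))"

definition radial_pd :: "'a pair_pre_digraph \<Rightarrow> (nat \<Rightarrow> complex) set"  (\<open>\<R>\<^sub>+\<close>) where
  "\<R>\<^sub>+ X = {\<phi>. positive_definite_on (pverts X) (\<lambda>x y. \<phi> (graph_dist X x y))}"

text \<open>
  In a symmetric digraph every edge, traversed back and forth, is a cycle of
  length two in the sense of \<^const>\<open>pre_digraph.cycle\<close>; the cycles of the underlying
  undirected graph are those of length at least three. For this reason
  \<^const>\<open>Digraph_Component.tree\<close> is not the right notion here.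
\<close>

definition undirected_tree :: "'a pair_pre_digraph \<Rightarrow> bool" where
  "undirected_tree T \<longleftrightarrow> connected_graph T \<and>
    \<not> (\<exists>p. pre_digraph.cycle (with_proj T) p \<and> 3 \<le> length p)"

text \<open>
  The homogeneous tree of countably infinite degree is determined up to isomorphism
  by the following property; \<open>homogeneous_tree_exists\<close> below provides a model.
\<close>

definition homogeneous_tree_inf :: "'a pair_pre_digraph \<Rightarrow> bool" where
  "homogeneous_tree_inf T \<longleftrightarrow> undirected_tree T \<and>
    (\<forall>v\<in>pverts T. countable {w. (v, w) \<in> parcs T} \<and> infinite {w. (v, w) \<in> parcs T})"

lemma graph_dist_eq_shortest_path:
  assumes "connected_graph X" "x \<in> pverts X" "y \<in> pverts X"
  shows "ereal (real (graph_dist X x y)) = wf_digraph.\<mu> (with_proj X) (\<lambda>_. 1) x y"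
proof -
  interpret pair_bidirected_digraph X using assms(1) by (simp add: connected_graph_def)
  have cost: "awalk_cost (\<lambda>_. 1) p = real (length p)" for p :: "('a \<times> 'a) list"
    by (induction p) auto
  have "x \<rightarrow>\<^sup>*\<^bsub>with_proj (mk_symmetric (with_proj X))\<^esub> y"
    using assms by (auto simp: connected_graph_def connected_def strongly_connected_def
        mk_symmetric_def)
  then have "x \<rightarrow>\<^sup>*\<^bsub>with_proj X\<^esub> y"
    using reachable_mk_symmetric_eq[OF pair_sym_arcs] by simp
  then have ex: "\<exists>n p. awalk x p y \<and> length p = n" by (simp add: reachable_awalk)
  have "\<exists>p. awalk x p y \<and> length p = graph_dist X x y"
    unfolding graph_dist_def by (rule LeastI_ex[OF ex])
  then obtain p where p: "awalk x p y" "length p = graph_dist X x y" by blast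
  have le: "graph_dist X x y \<le> length q" if "awalk x q y" for q
    unfolding graph_dist_def by (rule Least_le) (use that in auto)
  show ?thesis unfolding \<mu>_def cost
  proof (rule antisym)
    show "ereal (real (graph_dist X x y)) \<le> (INF p\<in>{p. awalk x p y}. ereal (real (length p)))"
      using le by (intro INF_greatest) auto
    show "(INF p\<in>{p. awalk x p y}. ereal (real (length p))) \<le> ereal (real (graph_dist X x y))"
      using p by (metis (mono_tags, lifting) INF_lower mem_Collect_eq)
  qed
qed

lemma homogeneous_tree_exists: "\<exists>T :: nat list pair_pre_digraph. homogeneous_tree_inf T"
proof -
  define T :: "nat list pair_pre_digraph" where
    "T = \<lparr> pverts = UNIV, parcs = {(xs, ys). \<exists>n. ys = n # xs \<or> xs = n # ys} \<rparr>"
  interpret pair_bidirected_digraph T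
    by unfold_locales (auto simp: T_def symmetric_def sym_def)
  have to_root: "xs \<rightarrow>\<^sup>*\<^bsub>with_proj T\<^esub> []" for xs
  proof (induction xs)
    case (Cons n xs)
    have "(n # xs, xs) \<in> parcs T" by (auto simp: T_def)
    then have "(n # xs) \<rightarrow>\<^sup>*\<^bsub>with_proj T\<^esub> xs" by (intro reachable_adjI) simp
    then show ?case using Cons reachable_trans by blast
  next
    case Nil
    have "[] \<in> pverts T" by (simp add: T_def)
    then show ?case by (rule reachable_refl)
  qed
  have all: "xs \<rightarrow>\<^sup>*\<^bsub>with_proj T\<^esub> ys" for xs ys
    using to_root[of xs] symmetric_reachable[OF pair_sym_arcs to_root[of ys]]
      reachable_trans by blast
  then have conn: "connected_graph T"
  proof -
    have "pverts T = UNIV" by (simp add: T_def)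
    then have "strongly_connected (with_proj (mk_symmetric (with_proj T)))"
      unfolding strongly_connected_def reachable_mk_symmetric_eq[OF pair_sym_arcs]
      using all by (simp add: mk_symmetric_def)
    then show ?thesis
      by (simp add: connected_graph_def connected_def pair_bidirected_digraph_axioms)
  qed
  have False if p: "cycle p" "3 \<le> length p" for p
  proof -
    obtain u where u: "awalk u p u" "distinct (tl (pawalk_verts u p))"
      using p(1) by (auto simp: cycle_def)
    have ne: "p \<noteq> []" using p(2) by auto
    have "pcas u p u" and arcs: "set p \<subseteq> parcs T" using u(1) by (auto simp: awalk_def)
    have chain: "(\<forall>i. Suc i < length q \<longrightarrow> snd (q ! i) = fst (q ! Suc i)) \<and>
        (q \<noteq> [] \<longrightarrow> fst (hd q) = a \<and> snd (last q) = b) \<and> tl (pawalk_verts a q) = map snd q"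
      if "pcas a q b" for a b :: "nat list" and q
      using that
    proof (induction q arbitrary: a)
      case (Cons e q)
      then have e: "fst e = a" and q: "pcas (snd e) q b" by auto
      have "pawalk_verts (snd e) q = snd e # map snd q"
        using Cons.IH[OF q] by (cases q) (use q in auto)
      moreover have "snd ((e # q) ! i) = fst ((e # q) ! Suc i)" if "Suc i < length (e # q)" for i
        using that Cons.IH[OF q] by (cases i) (auto simp: hd_conv_nth)
      ultimately show ?case using Cons.IH[OF q] e q by auto
    qed auto
    note c = chain[OF \<open>pcas u p u\<close>]
    have dist: "distinct (map snd p)" using c u(2) by simp
    let ?n = "length p"
    obtain i where i: "i < ?n" and max: "\<And>k. k < ?n \<Longrightarrow> length (snd (p ! k)) \<le> length (snd (p ! i))"
    proof -
      have "finite ((\<lambda>k. length (snd (p ! k))) ` {..<?n})" by simp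
      moreover have "(\<lambda>k. length (snd (p ! k))) ` {..<?n} \<noteq> {}" using ne by auto
      ultimately have "Max ((\<lambda>k. length (snd (p ! k))) ` {..<?n}) \<in> (\<lambda>k. length (snd (p ! k))) ` {..<?n}"
        by (rule Max_in)
      then obtain i where "i < ?n" "Max ((\<lambda>k. length (snd (p ! k))) ` {..<?n}) = length (snd (p ! i))"
        by auto
      then show thesis using that[of i] by (metis (no_types, lifting) Max_ge finite_imageI
            finite_lessThan imageI lessThan_iff)
    qed
    define j where "j = (if Suc i < ?n then Suc i else 0)"
    define k where "k = (if i = 0 then ?n - 1 else i - 1)"
    have jk: "j < ?n" "k < ?n" "j \<noteq> k" using i p(2) by (auto simp: j_def k_def)
    have last: "snd (p ! (?n - 1)) = u" and first: "fst (p ! 0) = u"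
      using c ne by (auto simp: hd_conv_nth last_conv_nth)
    have fj: "fst (p ! j) = snd (p ! i)"
    proof (cases "Suc i < ?n")
      case False
      then have "i = ?n - 1" using i by simp
      then show ?thesis using False last first by (simp add: j_def)
    qed (use c j_def in auto)
    have fi: "fst (p ! i) = snd (p ! k)"
    proof (cases i)
      case (Suc m)
      then show ?thesis using c i by (auto simp: k_def)
    qed (use last first k_def in auto)
    have "(snd (p ! i), snd (p ! j)) \<in> parcs T" "(snd (p ! k), snd (p ! i)) \<in> parcs T"
      using arcs nth_mem[OF jk(1)] nth_mem[OF i] fj fi by (metis prod.collapse subsetD)+
    then have "snd (p ! j) = tl (snd (p ! i))" "snd (p ! k) = tl (snd (p ! i))"
      using max[OF jk(1)] max[OF jk(2)] by (auto simp: T_def)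
    then show False
      using dist jk by (metis length_map nth_eq_iff_index_eq nth_map)
  qed
  then have "undirected_tree T" using conn by (auto simp: undirected_tree_def)
  moreover have "infinite {w. (v, w) \<in> parcs T}" for v
  proof
    assume "finite {w. (v, w) \<in> parcs T}"
    moreover have "range (\<lambda>n. n # v) \<subseteq> {w. (v, w) \<in> parcs T}" by (auto simp: T_def)
    ultimately have "finite (range (\<lambda>n. n # v))" by (rule rev_finite_subset)
    then show False using finite_imageD[of "\<lambda>n. n # v" UNIV] by (simp add: inj_on_def)
  qed
  ultimately show ?thesis unfolding homogeneous_tree_inf_def by blast
qed

end

(*
  Averaging over many rays of the tree shows that a function phi in R_+(T) is bounded and
  that the Hankel kernel phi(a + b) is positive definite.  Both properties are inherited by
  phi(n) + phi(n + 1) and phi(n) - phi(n + 1), which are multiplication by 1 + s and 1 - s in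
  the representation of phi by the moments of a measure on [-1,1]; splitting off one coordinate
  at a time, phi composed with the Hamming distance is therefore positive definite on every
  finite cube.  Finally, the halfspaces of a median graph embed it isometrically into a cube.
*)

theory Submission
  imports Defs
begin

section \<open>Positive definite kernels of Hankel type\<close>

text \<open>The measure of the overview guides the proof but is never constructed: closure of
  \<open>bounded_hankel_pd\<close> under the two combinations replaces the moment problem. They come
  from the cube, where the kernel s^d is a tensor product of the 2x2 matrices with rows (1, s) and
  (s, 1), whose eigenvalues are 1 + s and 1 - s. Infinite degree supplies arbitrarily many rays from
  one vertex. Two points on different rays are at distance i + j, two on a common ray are not, so
  the Hankel kernel appears only when the pairs on a common ray become negligible. The isometry
  rests on one fact: a halfspace is determined by any edge that leaves it, so a geodesic crosses
  each wall at most once.\<close>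

definition real_pd :: "'a set \<Rightarrow> ('a \<Rightarrow> 'a \<Rightarrow> real) \<Rightarrow> bool" where
  "real_pd S \<kappa> \<longleftrightarrow> (\<forall>n x c. (\<forall>i<(n::nat). x i \<in> S) \<longrightarrow>
      0 \<le> (\<Sum>i<n. \<Sum>j<n. \<kappa> (x i) (x j) * c i * c j))"

text \<open>Later families are indexed by products: point and shift in the Cauchy-Schwarz argument,
  ray and point in the averaging.\<close>

lemma real_pdD:
  assumes "real_pd S \<kappa>" "finite I" "\<And>i. i \<in> I \<Longrightarrow> x i \<in> S"
  shows "0 \<le> (\<Sum>i\<in>I. \<Sum>j\<in>I. \<kappa> (x i) (x j) * c i * c j)"
proof -
  obtain h where h: "bij_betw h {0..<card I} I"
    using ex_bij_betw_nat_finite assms(2) by blast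
  then have h': "bij_betw h {..<card I} I" by (simp add: lessThan_atLeast0)
  have "\<forall>i<card I. x (h i) \<in> S"
    using h' assms(3) by (auto simp: bij_betw_def)
  then have "0 \<le> (\<Sum>i<card I. \<Sum>j<card I. \<kappa> (x (h i)) (x (h j)) * c (h i) * c (h j))"
    using assms(1)[unfolded real_pd_def, rule_format, of "card I" "x \<circ> h" "c \<circ> h"] by simp
  also have "\<dots> = (\<Sum>i<card I. \<Sum>j\<in>I. \<kappa> (x (h i)) (x j) * c (h i) * c j)"
    by (intro sum.cong refl sum.reindex_bij_betw[OF h'])
  also have "\<dots> = (\<Sum>i\<in>I. \<Sum>j\<in>I. \<kappa> (x i) (x j) * c i * c j)"
    by (rule sum.reindex_bij_betw[OF h'])
  finally show ?thesis .
qed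

lemma positive_definite_on_imp_real_pd:
  assumes "positive_definite_on S \<psi>"
  shows "real_pd S (\<lambda>x y. Re (\<psi> x y))"
  unfolding real_pd_def
proof (intro allI impI)
  fix n :: nat and x c assume x: "\<forall>i<n. x i \<in> S"
  have "0 \<le> (\<Sum>i<n. \<Sum>j<n. \<psi> (x i) (x j) * cnj (of_real (c i)) * of_real (c j))"
    using assms[unfolded positive_definite_on_def, rule_format, of n x "\<lambda>i. of_real (c i)"] x
    by simp
  then have "0 \<le> Re (\<Sum>i<n. \<Sum>j<n. \<psi> (x i) (x j) * cnj (of_real (c i)) * of_real (c j))"
    by (simp add: less_eq_complex_def)
  then show "0 \<le> (\<Sum>i<n. \<Sum>j<n. Re (\<psi> (x i) (x j)) * c i * c j)"
    by (simp add: algebra_simps)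
qed

text \<open>The real part of the form splits into the forms at \<open>Re\<close> and
  \<open>Im\<close> of the coefficients; symmetry makes the sum self-conjugate, hence real.\<close>

lemma real_pd_imp_positive_definite_on:
  assumes pd: "real_pd S \<kappa>" and sym: "\<And>x y. x \<in> S \<Longrightarrow> y \<in> S \<Longrightarrow> \<kappa> x y = \<kappa> y x"
  shows "positive_definite_on S (\<lambda>x y. complex_of_real (\<kappa> x y))"
  unfolding positive_definite_on_def
proof (intro allI impI)
  fix n :: nat and x and z :: "nat \<Rightarrow> complex" assume x: "\<forall>i<n. x i \<in> S"
  let ?s = "\<Sum>i<n. \<Sum>j<n. of_real (\<kappa> (x i) (x j)) * cnj (z i) * z j"
  have re: "0 \<le> (\<Sum>i<n. \<Sum>j<n. \<kappa> (x i) (x j) * Re (z i) * Re (z j))"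
    and im: "0 \<le> (\<Sum>i<n. \<Sum>j<n. \<kappa> (x i) (x j) * Im (z i) * Im (z j))"
    using pd x unfolding real_pd_def by auto
  have Re: "Re ?s = (\<Sum>i<n. \<Sum>j<n. \<kappa> (x i) (x j) * Re (z i) * Re (z j))
      + (\<Sum>i<n. \<Sum>j<n. \<kappa> (x i) (x j) * Im (z i) * Im (z j))"
    by (simp add: sum.distrib[symmetric] algebra_simps)
  have "cnj ?s = (\<Sum>i<n. \<Sum>j<n. of_real (\<kappa> (x j) (x i)) * cnj (z j) * z i)"
    unfolding cnj_sum
  proof (intro sum.cong refl)
    fix i j assume "i \<in> {..<n}" "j \<in> {..<n}"
    then have "\<kappa> (x i) (x j) = \<kappa> (x j) (x i)" using x sym by simp
    then show "cnj (of_real (\<kappa> (x i) (x j)) * cnj (z i) * z j) =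
        of_real (\<kappa> (x j) (x i)) * cnj (z j) * z i" by simp
  qed
  then have "cnj ?s = ?s" by (rule trans) (rule sum.swap)
  moreover have "Im w = 0" if "cnj w = w" for w using that by (simp add: complex_eq_iff)
  ultimately have "Im ?s = 0" by blast
  with Re re im show "0 \<le> ?s" by (simp add: less_eq_complex_def)
qed

text \<open>Hankel positivity characterises moments of a positive measure on the real line;
  boundedness confines its support to [-1,1].\<close>

definition bounded_hankel_pd :: "(nat \<Rightarrow> real) \<Rightarrow> bool" where
  "bounded_hankel_pd r \<longleftrightarrow>
    real_pd UNIV (\<lambda>a b. r (a + b)) \<and> (\<exists>K. \<forall>n. \<bar>r n\<bar> \<le> K)"

text \<open>
  By Cauchy--Schwarz \<open>(s m)\<^sup>2 \<le> s 0 * s (2 * m)\<close>; iterating over \<open>m = 2 ^ k\<close>, a ratio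
  \<open>\<bar>s 1\<bar> / s 0 > 1\<close> would make \<open>s\<close> unbounded.
\<close>

lemma bounded_hankel_pd_shift_bound:
  fixes x :: "nat \<Rightarrow> nat" and c :: "nat \<Rightarrow> real" and n :: nat
  assumes r: "bounded_hankel_pd r"
  defines "s \<equiv> \<lambda>m. \<Sum>i<n. \<Sum>j<n. r (x i + x j + m) * c i * c j"
  shows "\<bar>s 1\<bar> \<le> s 0"
proof (rule ccontr)
  assume "\<not> \<bar>s 1\<bar> \<le> s 0"
  then have less: "s 0 < \<bar>s 1\<bar>" by simp
  \<comment> \<open>With P(t) the sum of c_i t^(x_i), this is the Hankel form at the polynomial
    (\<alpha> + \<beta> t^m) P(t). The Boolean marks the copy shifted by \<open>m\<close>.\<close>
  have quad: "0 \<le> \<alpha>\<^sup>2 * s 0 + 2 * \<alpha> * \<beta> * s m + \<beta>\<^sup>2 * s (2 * m)" for \<alpha> \<beta> :: real and m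
  proof -
    let ?y = "\<lambda>p. x (fst p) + (if snd p then m else 0)"
    let ?e = "\<lambda>p. c (fst p) * (if snd p then \<beta> else \<alpha>)"
    have split: "(\<Sum>p\<in>{..<n} \<times> (UNIV::bool set). g p) = (\<Sum>i<n. g (i, False) + g (i, True))"
      for g :: "nat \<times> bool \<Rightarrow> real"
      by (simp add: sum.cartesian_product' UNIV_bool)
    have "0 \<le> (\<Sum>p\<in>{..<n} \<times> (UNIV::bool set). \<Sum>q\<in>{..<n} \<times> (UNIV::bool set).
        r (?y p + ?y q) * ?e p * ?e q)"
      by (rule real_pdD[where S=UNIV and \<kappa>="\<lambda>a b. r (a + b)" and x="?y"])
         (use r in \<open>auto simp: bounded_hankel_pd_def\<close>)
    also have "\<dots> = (\<Sum>i<n. \<Sum>j<n. \<alpha>\<^sup>2 * (r (x i + x j) * c i * c j)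
        + 2 * \<alpha> * \<beta> * (r (x i + x j + m) * c i * c j) + \<beta>\<^sup>2 * (r (x i + x j + 2 * m) * c i * c j))"
      unfolding split sum.distrib[symmetric]
    proof (intro sum.cong refl)
      fix i j
      have arg: "x i + (x j + m) = x i + x j + m" "x i + m + x j = x i + x j + m"
        "x i + m + (x j + m) = x i + x j + 2 * m" by simp_all
      show "r (?y (i, False) + ?y (j, False)) * ?e (i, False) * ?e (j, False) +
          r (?y (i, False) + ?y (j, True)) * ?e (i, False) * ?e (j, True) +
          (r (?y (i, True) + ?y (j, False)) * ?e (i, True) * ?e (j, False) +
           r (?y (i, True) + ?y (j, True)) * ?e (i, True) * ?e (j, True)) =
          \<alpha>\<^sup>2 * (r (x i + x j) * c i * c j) + 2 * \<alpha> * \<beta> * (r (x i + x j + m) * c i * c j) +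
          \<beta>\<^sup>2 * (r (x i + x j + 2 * m) * c i * c j)"
        unfolding fst_conv snd_conv if_True if_False add_0_right arg by algebra
    qed
    also have "\<dots> = \<alpha>\<^sup>2 * s 0 + 2 * \<alpha> * \<beta> * s m + \<beta>\<^sup>2 * s (2 * m)"
      by (simp add: s_def sum.distrib sum_distrib_left)
    finally show ?thesis .
  qed
  have pos: "0 \<le> s 0" using quad[of 1 0] by simp
  have "s 0 \<noteq> 0"
  proof
    assume "s 0 = 0"
    \<comment> \<open>Without its quadratic term the form at \<beta> = 1 is affine in \<alpha> with
      nonzero slope, so it takes negative values.\<close>
    then have "s 1 \<noteq> 0" and lin: "0 \<le> 2 * \<alpha> * s 1 + s 2" for \<alpha>
      using less quad[of \<alpha> 1 1] by (auto simp: numeral_2_eq_2)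
    then show False using lin[of "- (\<bar>s 2\<bar> + 1) / s 1"] by simp
  qed
  then have pos: "0 < s 0" using pos by simp
  \<comment> \<open>This choice of \<alpha> and \<beta> gives
    \<open>s 0 * (s 0 * s (2 * m) - (s m)\<^sup>2)\<close>, and \<open>s 0\<close> cancels.\<close>
  have cs: "(s m)\<^sup>2 \<le> s 0 * s (2 * m)" for m
    using quad[of "- s m" "s 0" m] pos
    by (simp add: power2_eq_square algebra_simps)
  define \<rho> where "\<rho> = \<bar>s 1\<bar> / s 0"
  have \<rho>: "1 < \<rho>" using less pos by (simp add: \<rho>_def)
  have grow: "s 0 * \<rho> ^ (2 ^ k) \<le> \<bar>s (2 ^ k)\<bar>" for k
  proof (induction k)
    case 0
    then show ?case using pos by (simp add: \<rho>_def)
  next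
    case (Suc k)
    have "(s 0 * \<rho> ^ (2 ^ k))\<^sup>2 \<le> (s (2 ^ k))\<^sup>2"
      using Suc pos \<rho> by (metis abs_le_square_iff abs_of_nonneg less_eq_real_def
          mult_nonneg_nonneg zero_le_power less_trans zero_less_one)
    also have "\<dots> \<le> s 0 * s (2 ^ Suc k)" using cs[of "2 ^ k"] by simp
    finally have "s 0 * (s 0 * \<rho> ^ (2 ^ Suc k)) \<le> s 0 * s (2 ^ Suc k)"
      by (simp add: power2_eq_square power_mult_distrib mult_2 power_add algebra_simps)
    then show ?case using pos by auto
  qed
  obtain K where K: "\<And>n. \<bar>r n\<bar> \<le> K" using r by (auto simp: bounded_hankel_pd_def)
  have bound: "\<bar>s m\<bar> \<le> (\<Sum>i<n. \<Sum>j<n. K * \<bar>c i\<bar> * \<bar>c j\<bar>)" for m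
    unfolding s_def
    by (intro order_trans[OF sum_abs] sum_mono)
       (auto simp: abs_mult intro!: mult_right_mono K)
  obtain k where k: "(\<Sum>i<n. \<Sum>j<n. K * \<bar>c i\<bar> * \<bar>c j\<bar>) / s 0 < \<rho> ^ k"
    using real_arch_pow[OF \<rho>] by blast
  have "\<rho> ^ k \<le> \<rho> ^ (2 ^ k)" using \<rho> by (intro power_increasing) (auto intro: less_imp_le)
  then have "(\<Sum>i<n. \<Sum>j<n. K * \<bar>c i\<bar> * \<bar>c j\<bar>) / s 0 < \<rho> ^ (2 ^ k)" using k by linarith
  then have "(\<Sum>i<n. \<Sum>j<n. K * \<bar>c i\<bar> * \<bar>c j\<bar>) < s 0 * \<rho> ^ (2 ^ k)"
    using pos by (simp add: field_simps)
  then show False using grow[of k] bound[of "2 ^ k"] by linarith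
qed

text \<open>The new form is \<open>s 0 + \<epsilon> * s 1\<close>, controlled by the preceding
  bound. The values 1 and -1 of \<epsilon> give the two factors for the cube.\<close>

lemma bounded_hankel_pd_shift:
  assumes r: "bounded_hankel_pd r" and \<epsilon>: "\<bar>\<epsilon>\<bar> \<le> 1"
  shows "bounded_hankel_pd (\<lambda>n. r n + \<epsilon> * r (Suc n))"
proof -
  obtain K where K: "\<And>n. \<bar>r n\<bar> \<le> K" using r by (auto simp: bounded_hankel_pd_def)
  have "\<bar>r n + \<epsilon> * r (Suc n)\<bar> \<le> K + K" for n
  proof -
    have "\<bar>\<epsilon> * r (Suc n)\<bar> \<le> 1 * K"
      unfolding abs_mult using \<epsilon> K by (intro mult_mono) auto
    then show ?thesis using K[of n] by linarith
  qed
  moreover have "real_pd UNIV (\<lambda>a b. r (a + b) + \<epsilon> * r (Suc (a + b)))"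
    unfolding real_pd_def
  proof (intro allI impI)
    fix n :: nat and x :: "nat \<Rightarrow> nat" and c
    define s where "s = (\<lambda>m. \<Sum>i<n. \<Sum>j<n. r (x i + x j + m) * c i * c j)"
    have "\<bar>s 1\<bar> \<le> s 0" unfolding s_def by (rule bounded_hankel_pd_shift_bound[OF r])
    moreover have "\<bar>\<epsilon> * s 1\<bar> \<le> 1 * \<bar>s 1\<bar>"
      unfolding abs_mult using \<epsilon> by (intro mult_right_mono) auto
    ultimately have "0 \<le> s 0 + \<epsilon> * s 1" by linarith
    then show "0 \<le> (\<Sum>i<n. \<Sum>j<n. (r (x i + x j) + \<epsilon> * r (Suc (x i + x j))) * c i * c j)"
      by (simp add: s_def sum_distrib_left sum.distrib[symmetric] algebra_simps)
  qed
  ultimately show ?thesis unfolding bounded_hankel_pd_def by blast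
qed

text \<open>
  For a coordinate \<open>w\<close> put \<open>e A = -1\<close> if \<open>w \<in> A\<close> and \<open>e A = 1\<close> otherwise. If \<open>k\<close> is the
  distance of \<open>A\<close> and \<open>B\<close> in the remaining coordinates, then their full distance \<open>k'\<close> satisfies
  \<open>2 * r k' = (r k + r (k + 1)) + e A * e B * (r k - r (k + 1))\<close>.
\<close>

lemma real_pd_cube:
  assumes "finite W" "bounded_hankel_pd r"
  shows "real_pd (Pow W) (\<lambda>A B. r (card (sym_diff A B)))"
  using assms
proof (induction W arbitrary: r rule: finite_induct)
  case empty
  have r0: "0 \<le> r 0"
    using real_pdD[of UNIV "\<lambda>a b. r (a + b)" "{0}" id "\<lambda>_. 1"] empty
    by (simp add: bounded_hankel_pd_def)
  show ?case unfolding real_pd_def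
  proof (intro allI impI)
    fix n :: nat and x :: "nat \<Rightarrow> 'a set" and c :: "nat \<Rightarrow> real"
    assume x: "\<forall>i<n. x i \<in> Pow {}"
    have "(\<Sum>i<n. \<Sum>j<n. r (card (sym_diff (x i) (x j))) * c i * c j) = r 0 * (\<Sum>i<n. c i)\<^sup>2"
      unfolding power2_eq_square sum_product using x by (simp add: sum_distrib_left mult.assoc)
    then show "0 \<le> (\<Sum>i<n. \<Sum>j<n. r (card (sym_diff (x i) (x j))) * c i * c j)"
      using r0 by simp
  qed
next
  case (insert w W)
  show ?case unfolding real_pd_def
  proof (intro allI impI)
    fix n :: nat and x :: "nat \<Rightarrow> 'a set" and c :: "nat \<Rightarrow> real"
    assume x: "\<forall>i<n. x i \<in> Pow (insert w W)"
    define y where "y = (\<lambda>i. x i - {w})"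
    define e where "e = (\<lambda>i. if w \<in> x i then -1 else 1 :: real)"
    let ?k = "\<lambda>i j. card (sym_diff (y i) (y j))"
    have y: "\<forall>i<n. y i \<in> Pow W" using x by (auto simp: y_def)
    have plus: "0 \<le> (\<Sum>i<n. \<Sum>j<n. (r (?k i j) + 1 * r (Suc (?k i j))) * c i * c j)"
      using insert.IH[OF bounded_hankel_pd_shift[OF insert.prems, of 1]] y
      unfolding real_pd_def by fastforce
    \<comment> \<open>The sign kernel \<open>e i * e j\<close> has rank one, so it is absorbed into
      the coefficients.\<close>
    have minus: "0 \<le> (\<Sum>i<n. \<Sum>j<n. (r (?k i j) + (-1) * r (Suc (?k i j))) * (e i * c i) * (e j * c j))"
      using insert.IH[OF bounded_hankel_pd_shift[OF insert.prems, of "-1"]] y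
      unfolding real_pd_def by fastforce
    have split: "2 * r (card (sym_diff (x i) (x j))) =
        (r (?k i j) + 1 * r (Suc (?k i j))) + (r (?k i j) + (-1) * r (Suc (?k i j))) * e i * e j"
      if "i < n" "j < n" for i j
    proof -
      have fin: "finite (sym_diff (y i) (y j))"
        using y that insert.hyps by (auto intro: finite_subset)
      show ?thesis
      proof (cases "(w \<in> x i) = (w \<in> x j)")
        case True
        then have "sym_diff (x i) (x j) = sym_diff (y i) (y j)" by (auto simp: y_def)
        then show ?thesis using True by (auto simp: e_def)
      next
        case False
        then have "sym_diff (x i) (x j) = insert w (sym_diff (y i) (y j))" by (auto simp: y_def)
        moreover have "w \<notin> sym_diff (y i) (y j)" by (auto simp: y_def)
        ultimately have "card (sym_diff (x i) (x j)) = Suc (?k i j)" using fin by simp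
        then show ?thesis using False by (auto simp: e_def)
      qed
    qed
    have "2 * (\<Sum>i<n. \<Sum>j<n. r (card (sym_diff (x i) (x j))) * c i * c j) =
        (\<Sum>i<n. \<Sum>j<n. (2 * r (card (sym_diff (x i) (x j)))) * c i * c j)"
      by (simp add: sum_distrib_left mult.assoc)
    also have "\<dots> = (\<Sum>i<n. \<Sum>j<n. (r (?k i j) + 1 * r (Suc (?k i j))) * c i * c j)
        + (\<Sum>i<n. \<Sum>j<n. (r (?k i j) + (-1) * r (Suc (?k i j))) * (e i * c i) * (e j * c j))"
      unfolding sum.distrib[symmetric]
      by (intro sum.cong refl, subst split) (auto simp: algebra_simps)
    finally show "0 \<le> (\<Sum>i<n. \<Sum>j<n. r (card (sym_diff (x i) (x j))) * c i * c j)"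
      using plus minus by linarith
  qed
qed

section \<open>Halfspaces in median spaces\<close>

text \<open>Keeps the halfspace argument free of walks. \<open>geodesic\<close> asks only for unit
  steps; that all intermediate distances are then realised is derived in
  \<open>card_separators\<close>.\<close>

locale median_metric =
  fixes V :: "'a set" and d :: "'a \<Rightarrow> 'a \<Rightarrow> nat"
  assumes d_eq_0: "x \<in> V \<Longrightarrow> y \<in> V \<Longrightarrow> d x y = 0 \<longleftrightarrow> x = y"
    and d_sym: "x \<in> V \<Longrightarrow> y \<in> V \<Longrightarrow> d x y = d y x"
    and d_triangle: "x \<in> V \<Longrightarrow> y \<in> V \<Longrightarrow> z \<in> V \<Longrightarrow> d x z \<le> d x y + d y z"
    and geodesic: "x \<in> V \<Longrightarrow> y \<in> V \<Longrightarrow> \<exists>f. f 0 = x \<and> f (d x y) = y \<and>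
      (\<forall>t\<le>d x y. f t \<in> V) \<and> (\<forall>t<d x y. d (f t) (f (Suc t)) = 1)"
    and median: "x \<in> V \<Longrightarrow> y \<in> V \<Longrightarrow> z \<in> V \<Longrightarrow> \<exists>!m. m \<in> V \<and>
      d x y = d x m + d m y \<and> d y z = d y m + d m z \<and> d z x = d z m + d m x"
begin

definition edge :: "'a \<Rightarrow> 'a \<Rightarrow> bool" where
  "edge u v \<longleftrightarrow> u \<in> V \<and> v \<in> V \<and> d u v = 1"

definition halfspace :: "'a \<Rightarrow> 'a \<Rightarrow> 'a set" where
  "halfspace u v = {x \<in> V. d x u < d x v}"

text \<open>Oriented, so that each wall between \<open>x\<close> and \<open>y\<close> contributes
  one of its two sides; \<open>separators y x\<close> consists of the complements.\<close>

definition separators :: "'a \<Rightarrow> 'a \<Rightarrow> 'a set set" where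
  "separators x y = {H. \<exists>u v. edge u v \<and> H = halfspace u v \<and> x \<in> H \<and> y \<notin> H}"

lemma edge_sym: "edge u v \<Longrightarrow> edge v u"
  by (auto simp: edge_def d_sym)

text \<open>The median of \<open>u\<close>, \<open>v\<close>, \<open>x\<close> lies on the edge,
  hence is \<open>u\<close> or \<open>v\<close>: a median graph is bipartite.\<close>

lemma edge_dist_cases:
  assumes "edge u v" "x \<in> V"
  shows "d x u = d x v + 1 \<or> d x v = d x u + 1"
proof -
  have uv: "u \<in> V" "v \<in> V" "d u v = 1" using assms(1) by (auto simp: edge_def)
  obtain m where m: "m \<in> V" "d u v = d u m + d m v" "d v x = d v m + d m x"
      "d x u = d x m + d m u"
    using median[OF uv(1,2) assms(2)] by blast
  then consider "d u m = 0" | "d m v = 0" using uv(3) by linarith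
  then show ?thesis
  proof cases
    case 1
    then have "m = u" using m(1) uv d_eq_0 by auto
    then show ?thesis using m(3) uv d_sym assms(2) by auto
  next
    case 2
    then have "m = v" using m(1) uv d_eq_0 by auto
    then show ?thesis using m(4) uv d_sym assms(2) by auto
  qed
qed

lemma halfspace_swap: "edge u v \<Longrightarrow> halfspace v u = V - halfspace u v"
  using edge_dist_cases by (fastforce simp: halfspace_def)

text \<open>A median of \<open>b\<close>, \<open>x\<close>, \<open>v\<close> is also a median of \<open>a\<close>, \<open>x\<close>, \<open>v\<close>, hence equal to \<open>m\<close>.\<close>

lemma dist_median:
  assumes V: "a \<in> V" "x \<in> V" "v \<in> V" "b \<in> V" "m \<in> V"
    and b: "d a x = d a b + d b x" "d a v = d a b + d b v"
    and m: "d a x = d a m + d m x" "d x v = d x m + d m v" "d v a = d v m + d m a"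
  shows "d a m = d a b + d b m"
proof -
  obtain m' where m': "m' \<in> V" "d b x = d b m' + d m' x" "d x v = d x m' + d m' v"
      "d v b = d v m' + d m' b"
    using median[OF V(4,2,3)] by blast
  have s: "d v b = d b v" "d v m' = d m' v" "d m' b = d b m'" "d v a = d a v" "d m' a = d a m'"
    using V m'(1) d_sym by auto
  have "d a m' \<le> d a b + d b m'" "d a x \<le> d a m' + d m' x" "d a v \<le> d a m' + d m' v"
    using V m'(1) d_triangle by auto
  then have *: "d a m' = d a b + d b m'" "d a x = d a m' + d m' x" "d v a = d v m' + d m' a"
    using b m' s by linarith+
  have "m' = m" using median[OF V(1,2,3)] V(5) m m' * by blast
  then show ?thesis using * by simp
qed

text \<open>
  If \<open>x\<close> lay on the side of \<open>b\<close>, then for the median \<open>m\<close> of \<open>a\<close>, \<open>x\<close>, \<open>v\<close> both edges would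
  lie on a geodesic from \<open>a\<close> through \<open>b\<close>, \<open>m\<close>, \<open>u\<close> to \<open>v\<close>, which is too long.
\<close>

lemma halfspace_crossing_subset:
  assumes uv: "edge u v" and ab: "edge a b" and a: "a \<in> halfspace u v" and b: "b \<in> halfspace v u"
  shows "halfspace u v \<subseteq> halfspace a b"
proof
  fix x assume x: "x \<in> halfspace u v"
  have V: "u \<in> V" "v \<in> V" "a \<in> V" "b \<in> V" "x \<in> V" and one: "d u v = 1" "d a b = 1"
    using uv ab x by (auto simp: edge_def halfspace_def)
  have av: "d a v = d a u + 1" and bu: "d b u = d b v + 1" and xv: "d x v = d x u + 1"
    using a b x edge_dist_cases[OF uv] V by (fastforce simp: halfspace_def)+
  show "x \<in> halfspace a b"
  proof (rule ccontr)
    assume "x \<notin> halfspace a b"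
    then have xa: "d x a = d x b + 1"
      using edge_dist_cases[OF ab V(5)] V by (auto simp: halfspace_def)
    have s: "d b a = 1" "d v u = 1" "d a x = d x a" "d b x = d x b" "d v a = d a v"
      "d v x = d x v" "d u x = d x u" "d u a = d a u" using V one d_sym by auto
    \<comment> \<open>Both inequalities are tight: the edge from \<open>a\<close> to
      \<open>b\<close> starts a geodesic from \<open>a\<close> to \<open>v\<close>.\<close>
    have "d a v \<le> d a b + d b v" "d b u \<le> d b a + d a u"
      using V d_triangle by auto
    then have bv: "d a v = d a b + d b v" using av bu one s by linarith
    obtain m where m: "m \<in> V" "d a x = d a m + d m x" "d x v = d x m + d m v"
        "d v a = d v m + d m a"
      using median[OF V(3,5,2)] by blast
    have sm: "d v m = d m v" "d m a = d a m" "d x m = d m x" "d m u = d u m" using V m(1) d_sym by auto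
    have "d a m = d a b + d b m"
      by (rule dist_median[OF V(3,5,2,4) m(1)]) (use m bv xa s one in simp_all)
    moreover have "d v m = d v u + d u m"
      by (rule dist_median[OF V(2,5,3,1) m(1)]) (use m sm av xv s one in simp_all)
    \<comment> \<open>The left side equals \<open>d a v\<close>, the right side
      \<open>d a m + d m v - 2 = d a v - 2\<close>.\<close>
    moreover have "d b u \<le> d b m + d m u" using V m(1) d_triangle by auto
    ultimately show False using m s sm one av bu bv by linarith
  qed
qed

text \<open>The converse inclusion is the same lemma for both edges reversed, after taking
  complements.\<close>

lemma halfspace_crossing_eq:
  assumes uv: "edge u v" and ab: "edge a b" and a: "a \<in> halfspace u v" and b: "b \<in> halfspace v u"
  shows "halfspace u v = halfspace a b"
proof -
  have "halfspace v u \<subseteq> halfspace b a"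
    using halfspace_crossing_subset edge_sym assms by blast
  then have "halfspace a b \<subseteq> halfspace u v"
    using halfspace_swap[OF uv] halfspace_swap[OF ab] by (auto simp: halfspace_def)
  then show ?thesis using halfspace_crossing_subset[OF assms] by blast
qed

text \<open>The edges of one geodesic enumerate the separators: each defines one, different edges
  define different ones, and a separator equals the halfspace of the edge by which the geodesic
  leaves it.\<close>

lemma card_separators:
  assumes V: "x \<in> V" "y \<in> V"
  shows "finite (separators x y) \<and> card (separators x y) = d x y"
proof -
  let ?n = "d x y"
  obtain f where f: "f 0 = x" "f ?n = y" "\<And>t. t \<le> ?n \<Longrightarrow> f t \<in> V"
      "\<And>t. t < ?n \<Longrightarrow> d (f t) (f (Suc t)) = 1"
    using geodesic[OF V] by blast
  have edge: "edge (f t) (f (Suc t))" if "t < ?n" for t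
    using f that by (simp add: edge_def)
  have le: "d (f s) (f (s + k)) \<le> k" if "s + k \<le> ?n" for s k
    using that
  proof (induction k)
    case 0
    then show ?case using f(3) d_eq_0 by auto
  next
    case (Suc k)
    have "d (f s) (f (s + Suc k)) \<le> d (f s) (f (s + k)) + d (f (s + k)) (f (Suc (s + k)))"
      using Suc.prems f(3) d_triangle by simp
    then show ?case using Suc f(4)[of "s + k"] by simp
  qed
  \<comment> \<open>A shortcut between two points of \<open>f\<close> would make \<open>x\<close>
    and \<open>y\<close> closer than \<open>?n\<close>.\<close>
  have dist: "d (f s) (f (s + k)) = k" if "s + k \<le> ?n" for s k
  proof -
    have "d x y \<le> d x (f s) + d (f s) y" "d (f s) y \<le> d (f s) (f (s + k)) + d (f (s + k)) y"
      using V f(3) that d_triangle by auto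
    moreover have "d x (f s) \<le> s" using le[of 0 s] that f by simp
    moreover have "d (f (s + k)) y \<le> ?n - (s + k)" using le[of "s + k" "?n - (s + k)"] that f by simp
    ultimately show ?thesis using le[OF that] that by linarith
  qed
  have before: "f s \<in> halfspace (f t) (f (Suc t))" if "s \<le> t" "t < ?n" for s t
    using dist[of s "t - s"] dist[of s "Suc t - s"] f(3) that by (simp add: halfspace_def)
  have after: "f s \<notin> halfspace (f t) (f (Suc t))" if "t < s" "s \<le> ?n" for s t
    using dist[of t "s - t"] dist[of "Suc t" "s - Suc t"] f(3) d_sym that
    by (simp add: halfspace_def)
  have "bij_betw (\<lambda>t. halfspace (f t) (f (Suc t))) {..<?n} (separators x y)"
  proof (rule bij_betw_imageI)
    show "inj_on (\<lambda>t. halfspace (f t) (f (Suc t))) {..<?n}"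
    proof (rule linorder_inj_onI')
      fix i j assume "i \<in> {..<?n}" "j \<in> {..<?n}" "i < j"
      then show "halfspace (f i) (f (Suc i)) \<noteq> halfspace (f j) (f (Suc j))"
        using before[of "Suc i" j] after[of i "Suc i"] by auto
    qed
    show "(\<lambda>t. halfspace (f t) (f (Suc t))) ` {..<?n} = separators x y"
    proof (intro equalityI subsetI)
      fix H assume "H \<in> (\<lambda>t. halfspace (f t) (f (Suc t))) ` {..<?n}"
      then obtain t where t: "t < ?n" "H = halfspace (f t) (f (Suc t))" by auto
      then show "H \<in> separators x y"
        using edge before[of 0 t] after[of t ?n] f unfolding separators_def by auto
    next
      fix H assume "H \<in> separators x y"
      then obtain u v where H: "edge u v" "H = halfspace u v" "x \<in> H" "y \<notin> H"
        by (auto simp: separators_def)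
      \<comment> \<open>The first exit from \<open>H\<close>; one exists because \<open>f\<close>
        ends at \<open>y\<close>.\<close>
      define t where "t = (LEAST t. f (Suc t) \<notin> H)"
      have "?n \<noteq> 0" using H f by (metis)
      then have ex: "f (Suc (?n - 1)) \<notin> H" using f(2) H by simp
      have t: "f (Suc t) \<notin> H" unfolding t_def using ex by (rule LeastI[where P="\<lambda>t. f (Suc t) \<notin> H"])
      have "t \<le> ?n - 1" unfolding t_def using ex by (rule Least_le[where P="\<lambda>t. f (Suc t) \<notin> H"])
      then have tn: "t < ?n" using \<open>?n \<noteq> 0\<close> by simp
      have "f t \<in> H"
      proof (cases t)
        case 0
        then show ?thesis using H f by simp
      next
        case (Suc k)
        then show ?thesis using not_less_Least[of k "\<lambda>t. f (Suc t) \<notin> H"] t_def by auto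
      qed
      then have "H = halfspace (f t) (f (Suc t))"
        using halfspace_crossing_eq[OF H(1) edge[OF tn]] H(2) t tn f(3) halfspace_swap[OF H(1)]
        by auto
      then show "H \<in> (\<lambda>t. halfspace (f t) (f (Suc t))) ` {..<?n}" using tn by auto
    qed
  qed
  then show ?thesis using bij_betw_finite bij_betw_same_card by fastforce
qed

text \<open>The base point \<open>z\<close> makes the embedded sets finite. Complementing the part
  \<open>?M\<close> of the symmetric difference completes \<open>?P\<close> to all separators of
  \<open>x\<close> from \<open>y\<close>.\<close>

lemma card_sym_diff_separators:
  assumes V: "x \<in> V" "y \<in> V" "z \<in> V"
  shows "card (sym_diff (separators x z) (separators y z)) = d x y"
proof -
  let ?P = "{H \<in> separators x y. z \<notin> H}" and ?N = "{H \<in> separators x y. z \<in> H}"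
    and ?M = "{H \<in> separators y x. z \<notin> H}"
  have fin: "finite (separators x y)" "finite (separators y x)" using card_separators V by auto
  have "bij_betw (\<lambda>H. V - H) ?M ?N"
  proof (rule bij_betw_byWitness[where f'="\<lambda>H. V - H"])
    have "V - H \<in> separators q p" if "H \<in> separators p q" "q \<in> V" for p q H
      using that halfspace_swap edge_sym unfolding separators_def by blast
    then show "(\<lambda>H. V - H) ` ?M \<subseteq> ?N" "(\<lambda>H. V - H) ` ?N \<subseteq> ?M" using V by auto
  qed (auto simp: separators_def halfspace_def)
  then have "card ?M = card ?N" by (rule bij_betw_same_card)
  moreover have "sym_diff (separators x z) (separators y z) = ?P \<union> ?M"
    unfolding separators_def by blast
  moreover have "card (?P \<union> ?M) = card ?P + card ?M"
    using fin by (intro card_Un_disjoint) (auto simp: separators_def)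
  moreover have "card ?P + card ?N = card (?P \<union> ?N)"
    using fin by (intro card_Un_disjoint[symmetric]) auto
  moreover have "?P \<union> ?N = separators x y" by auto
  ultimately show ?thesis using card_separators V by simp
qed

end

section \<open>Walks and distances in graphs\<close>

text \<open>Values beyond \<open>n\<close> are free, so one function can serve as an infinite ray,
  and reversing or shifting is a change of index.\<close>

definition fun_walk :: "'a pair_pre_digraph \<Rightarrow> (nat \<Rightarrow> 'a) \<Rightarrow> nat \<Rightarrow> bool" where
  "fun_walk X f n \<longleftrightarrow> (\<forall>t<n. (f t, f (Suc t)) \<in> parcs X)"

definition walk_arcs :: "(nat \<Rightarrow> 'a) \<Rightarrow> nat \<Rightarrow> ('a \<times> 'a) list" where
  "walk_arcs f n = map (\<lambda>t. (f t, f (Suc t))) [0..<n]"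

lemma walk_arcs_Suc: "walk_arcs f (Suc n) = (f 0, f 1) # walk_arcs (\<lambda>t. f (Suc t)) n"
  unfolding walk_arcs_def by (subst upt_conv_Cons) (simp_all add: map_Suc_upt[symmetric] del: upt_Suc)

lemma pawalk_verts_walk_arcs: "pawalk_verts (f 0) (walk_arcs f n) = map f [0..<Suc n]"
proof (induction n arbitrary: f)
  case 0
  then show ?case by (simp add: walk_arcs_def)
next
  case (Suc n)
  have "map f [0..<Suc (Suc n)] = f 0 # map (\<lambda>t. f (Suc t)) [0..<Suc n]"
    by (subst upt_conv_Cons) (simp_all add: map_Suc_upt[symmetric] del: upt_Suc)
  then show ?case using Suc[of "\<lambda>t. f (Suc t)"] by (simp add: walk_arcs_Suc)
qed

lemma pcas_walk_arcs: "pcas (f 0) (walk_arcs f n) (f n)"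
proof (induction n arbitrary: f)
  case 0
  then show ?case by (simp add: walk_arcs_def)
next
  case (Suc n)
  then show ?case using Suc[of "\<lambda>t. f (Suc t)"] by (simp add: walk_arcs_Suc)
qed

lemma awalk_walk_arcs:
  assumes "fun_walk X f n" "f 0 \<in> pverts X"
  shows "pre_digraph.awalk (with_proj X) (f 0) (walk_arcs f n) (f n)"
  using assms pcas_walk_arcs[of f n]
  by (auto simp: pre_digraph.awalk_def cas_with_proj_eq fun_walk_def walk_arcs_def)

lemma fun_walk_of_awalk:
  assumes "pre_digraph.awalk (with_proj X) x p y"
  shows "\<exists>f. f 0 = x \<and> f (length p) = y \<and> fun_walk X f (length p)"
proof -
  have "pcas x p y" "set p \<subseteq> parcs X"
    using assms by (auto simp: pre_digraph.awalk_def cas_with_proj_eq)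
  then show ?thesis
  proof (induction p arbitrary: x)
    case Nil
    then show ?case by (intro exI[of _ "\<lambda>_. x"]) (simp add: fun_walk_def)
  next
    case (Cons e p)
    then obtain f where f: "f 0 = snd e" "f (length p) = y" "fun_walk X f (length p)" by auto
    have "(case_nat x f t, case_nat x f (Suc t)) \<in> parcs X" if "t < Suc (length p)" for t
      using f Cons.prems that by (cases t) (auto simp: fun_walk_def)
    then show ?case using f by (intro exI[of _ "case_nat x f"]) (simp add: fun_walk_def)
  qed
qed

lemma connected_graph_arcs:
  assumes "connected_graph X" "(u, v) \<in> parcs X"
  shows "(v, u) \<in> parcs X" "u \<noteq> v" "u \<in> pverts X" "v \<in> pverts X"
proof -
  interpret pair_bidirected_digraph X using assms(1) by (simp add: connected_graph_def)
  show "(v, u) \<in> parcs X" using pair_sym_arcs assms(2) by (auto simp: symmetric_def sym_def)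
  show "u \<noteq> v" using pair_no_loops[OF assms(2)] by simp
  show "u \<in> pverts X" "v \<in> pverts X" using assms(2) wellformed' by auto
qed

lemma fun_walk_in_verts:
  assumes "connected_graph X" "fun_walk X f n" "f 0 \<in> pverts X" "t \<le> n"
  shows "f t \<in> pverts X"
proof (cases t)
  case (Suc s)
  then have "(f s, f t) \<in> parcs X" using assms by (simp add: fun_walk_def)
  then show ?thesis using connected_graph_arcs[OF assms(1)] by blast
qed (use assms in simp)

lemma graph_dist_le:
  assumes "fun_walk X f n" "f 0 \<in> pverts X"
  shows "graph_dist X (f 0) (f n) \<le> n"
  unfolding graph_dist_def
proof (rule Least_le)
  show "\<exists>p. pre_digraph.awalk (with_proj X) (f 0) p (f n) \<and> length p = n"
    using awalk_walk_arcs[OF assms] by (intro exI[of _ "walk_arcs f n"]) (simp add: walk_arcs_def)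
qed

lemma graph_dist_walk:
  assumes "connected_graph X" "x \<in> pverts X" "y \<in> pverts X"
  shows "\<exists>f. f 0 = x \<and> f (graph_dist X x y) = y \<and> fun_walk X f (graph_dist X x y)"
proof -
  interpret pair_bidirected_digraph X using assms(1) by (simp add: connected_graph_def)
  have "x \<rightarrow>\<^sup>*\<^bsub>with_proj (mk_symmetric (with_proj X))\<^esub> y"
    using assms by (auto simp: connected_graph_def connected_def strongly_connected_def
        mk_symmetric_def)
  then have "\<exists>n p. awalk x p y \<and> length p = n"
    using reachable_mk_symmetric_eq[OF pair_sym_arcs] by (simp add: reachable_awalk)
  then have "\<exists>p. awalk x p y \<and> length p = graph_dist X x y"
    unfolding graph_dist_def by (rule LeastI_ex)
  then show ?thesis using fun_walk_of_awalk by metis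
qed

lemma fun_walk_rev:
  assumes "connected_graph X" "fun_walk X f n"
  shows "fun_walk X (\<lambda>t. f (n - t)) n"
  unfolding fun_walk_def
proof (intro allI impI)
  fix t assume "t < n"
  then have "(f (n - Suc t), f (Suc (n - Suc t))) \<in> parcs X" using assms(2) by (simp add: fun_walk_def)
  moreover have "Suc (n - Suc t) = n - t" using \<open>t < n\<close> by simp
  ultimately show "(f (n - t), f (n - Suc t)) \<in> parcs X"
    using connected_graph_arcs(1)[OF assms(1)] by metis
qed

lemma graph_dist_le_sym:
  assumes "connected_graph X" "x \<in> pverts X" "y \<in> pverts X"
  shows "graph_dist X y x \<le> graph_dist X x y"
proof -
  obtain f where f: "f 0 = x" "f (graph_dist X x y) = y" "fun_walk X f (graph_dist X x y)"
    using graph_dist_walk[OF assms] by blast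
  then show ?thesis using graph_dist_le[OF fun_walk_rev[OF assms(1) f(3)]] assms by simp
qed

lemma graph_dist_sym:
  assumes "connected_graph X" "x \<in> pverts X" "y \<in> pverts X"
  shows "graph_dist X x y = graph_dist X y x"
  using graph_dist_le_sym[OF assms(1,2,3)] graph_dist_le_sym[OF assms(1,3,2)] by (rule antisym[rotated])

lemma graph_dist_eq_0:
  assumes "connected_graph X" "x \<in> pverts X" "y \<in> pverts X"
  shows "graph_dist X x y = 0 \<longleftrightarrow> x = y"
proof
  assume "graph_dist X x y = 0"
  then show "x = y" using graph_dist_walk[OF assms] by auto
next
  assume "x = y"
  then show "graph_dist X x y = 0" using graph_dist_le[of X "\<lambda>_. x" 0] assms by (simp add: fun_walk_def)
qed

text \<open>Runs \<open>q\<close> backwards to the common start, then \<open>p\<close>. This glues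
  paths for the triangle inequality, closed walks in a tree, and pairs of rays.\<close>

definition join_walks :: "(nat \<Rightarrow> 'a) \<Rightarrow> nat \<Rightarrow> (nat \<Rightarrow> 'a) \<Rightarrow> nat \<Rightarrow> 'a" where
  "join_walks q m p = (\<lambda>t. if t \<le> m then q (m - t) else p (t - m))"

lemma fun_walk_join:
  assumes "connected_graph X" "fun_walk X q m" "fun_walk X p n" "q 0 = p 0"
  shows "fun_walk X (join_walks q m p) (m + n)"
  unfolding fun_walk_def
proof (intro allI impI)
  fix t assume t: "t < m + n"
  consider "t < m" | "t = m" | "m < t" by linarith
  then show "(join_walks q m p t, join_walks q m p (Suc t)) \<in> parcs X"
  proof cases
    case 1
    then show ?thesis using fun_walk_rev[OF assms(1,2)] by (simp add: join_walks_def fun_walk_def)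
  next
    case 2
    then have "(p 0, p (Suc 0)) \<in> parcs X" using assms(3) t by (simp add: fun_walk_def)
    then show ?thesis using 2 assms(4) by (simp add: join_walks_def)
  next
    case 3
    then have "(p (t - m), p (Suc (t - m))) \<in> parcs X" using assms(3) t by (simp add: fun_walk_def)
    then show ?thesis using 3 by (simp add: join_walks_def Suc_diff_le)
  qed
qed

lemma graph_dist_triangle:
  assumes "connected_graph X" "x \<in> pverts X" "y \<in> pverts X" "z \<in> pverts X"
  shows "graph_dist X x z \<le> graph_dist X x y + graph_dist X y z"
proof -
  let ?m = "graph_dist X y x" and ?n = "graph_dist X y z"
  obtain f where f: "f 0 = y" "f ?m = x" "fun_walk X f ?m"
    using graph_dist_walk[OF assms(1,3,2)] by blast
  obtain g where g: "g 0 = y" "g ?n = z" "fun_walk X g ?n"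
    using graph_dist_walk[OF assms(1,3,4)] by blast
  have "fun_walk X (join_walks f ?m g) (?m + ?n)"
    by (rule fun_walk_join[OF assms(1) f(3) g(3)]) (simp add: f g)
  moreover have "join_walks f ?m g 0 = x" "join_walks f ?m g (?m + ?n) = z"
    using f g by (auto simp: join_walks_def)
  ultimately have "graph_dist X x z \<le> ?m + ?n"
    using graph_dist_le[of X "join_walks f ?m g" "?m + ?n"] assms(2) by simp
  then show ?thesis using graph_dist_sym[OF assms(1-3)] by simp
qed

lemma graph_dist_arc:
  assumes "connected_graph X" "(u, v) \<in> parcs X"
  shows "graph_dist X u v = 1"
proof -
  note uv = connected_graph_arcs[OF assms]
  have "graph_dist X u v \<le> 1"
    using graph_dist_le[of X "\<lambda>t. if t = 0 then u else v" 1] assms uv by (simp add: fun_walk_def)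
  moreover have "graph_dist X u v \<noteq> 0" using graph_dist_eq_0[OF assms(1) uv(3,4)] uv(2) by simp
  ultimately show ?thesis by simp
qed

lemma median_graph_metric:
  assumes "median_graph X"
  shows "median_metric (pverts X) (graph_dist X)"
proof
  have con: "connected_graph X" using assms by (simp add: median_graph_def)
  fix x y z assume x: "x \<in> pverts X" and y: "y \<in> pverts X"
  show "graph_dist X x y = 0 \<longleftrightarrow> x = y" using graph_dist_eq_0[OF con x y] .
  show "graph_dist X x y = graph_dist X y x" using graph_dist_sym[OF con x y] .
  obtain f where f: "f 0 = x" "f (graph_dist X x y) = y" "fun_walk X f (graph_dist X x y)"
    using graph_dist_walk[OF con x y] by blast
  then show "\<exists>f. f 0 = x \<and> f (graph_dist X x y) = y \<and> (\<forall>t\<le>graph_dist X x y. f t \<in> pverts X) \<and>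
      (\<forall>t<graph_dist X x y. graph_dist X (f t) (f (Suc t)) = 1)"
    using fun_walk_in_verts[OF con f(3)] graph_dist_arc[OF con] x
    by (intro exI[of _ f]) (auto simp: fun_walk_def)
  assume z: "z \<in> pverts X"
  show "graph_dist X x z \<le> graph_dist X x y + graph_dist X y z"
    using graph_dist_triangle[OF con x y z] .
  have "card (interval X x y \<inter> interval X y z \<inter> interval X z x) = 1"
    using assms x y z by (simp add: median_graph_def)
  then obtain m where "interval X x y \<inter> interval X y z \<inter> interval X z x = {m}"
    by (meson card_1_singletonE)
  then show "\<exists>!m. m \<in> pverts X \<and> graph_dist X x y = graph_dist X x m + graph_dist X m y \<and>
      graph_dist X y z = graph_dist X y m + graph_dist X m z \<and>
      graph_dist X z x = graph_dist X z m + graph_dist X m x"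
    unfolding interval_def set_eq_iff by (intro ex1I[of _ m]) auto
qed

section \<open>Reduced walks in trees\<close>

definition reduced :: "(nat \<Rightarrow> 'a) \<Rightarrow> nat \<Rightarrow> bool" where
  "reduced f n \<longleftrightarrow> (\<forall>t. t + 2 \<le> n \<longrightarrow> f t \<noteq> f (t + 2))"

text \<open>A closed subwalk of minimal length \<open>k\<close> repeats no vertex except at its
  ends. Loop-freeness excludes length 1 and reducedness length 2, so it is a forbidden
  cycle.\<close>

lemma tree_reduced_walk_inj:
  assumes T: "undirected_tree T" and f: "fun_walk T f n" "reduced f n" "f 0 \<in> pverts T"
  shows "inj_on f {..n}"
proof (rule ccontr)
  have con: "connected_graph T" using T by (simp add: undirected_tree_def)
  let ?P = "\<lambda>k. 0 < k \<and> (\<exists>i. i + k \<le> n \<and> f i = f (i + k))"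
  assume "\<not> inj_on f {..n}"
  then obtain i j where ij: "i \<le> n" "j \<le> n" "i < j" "f i = f j"
    by (metis (no_types, opaque_lifting) atMost_iff inj_onI linorder_neqE_nat)
  then have ex: "?P (j - i)" by (intro conjI exI[of _ i]) auto
  define k where "k = (LEAST k. ?P k)"
  have "?P k" unfolding k_def using ex by (rule LeastI[where P="?P"])
  then obtain i where k: "0 < k" "i + k \<le> n" "f i = f (i + k)" by blast
  have min: "f a \<noteq> f (a + l)" if "0 < l" "l < k" "a + l \<le> n" for a l
    using that not_less_Least[of l ?P] unfolding k_def by blast
  define g where "g = (\<lambda>t. f (i + t))"
  have g: "fun_walk T g k" using f(1) k(2) by (auto simp: g_def fun_walk_def)
  have g0: "g 0 \<in> pverts T" using fun_walk_in_verts[OF con f(1,3)] k(2) by (simp add: g_def)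
  have gk: "g k = g 0" using k by (simp add: g_def)
  have "k \<noteq> 1"
    using g gk connected_graph_arcs(2)[OF con, of "g 0" "g 1"] by (auto simp: fun_walk_def)
  moreover have "k \<noteq> 2" using f(2) k by (auto simp: reduced_def)
  ultimately have "3 \<le> k" using k(1) by linarith
  have "inj_on g {1..<Suc k}"
  proof (rule linorder_inj_onI')
    fix a b assume "a \<in> {1..<Suc k}" "b \<in> {1..<Suc k}" "a < b"
    then show "g a \<noteq> g b" using min[of "b - a" "i + a"] k(2) by (simp add: g_def)
  qed
  then have "distinct (map g [1..<Suc k])" by (simp add: distinct_map del: upt_Suc)
  moreover have "tl (map g [0..<Suc k]) = map g [1..<Suc k]"
    by (subst upt_conv_Cons) (simp_all del: upt_Suc)
  ultimately have "distinct (tl (pawalk_verts (g 0) (walk_arcs g k)))"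
    by (simp add: pawalk_verts_walk_arcs del: upt_Suc)
  moreover have "3 \<le> length (walk_arcs g k)" using \<open>3 \<le> k\<close> by (simp add: walk_arcs_def)
  moreover from this have "walk_arcs g k \<noteq> []" by auto
  ultimately have "pre_digraph.cycle (with_proj T) (walk_arcs g k)"
      "3 \<le> length (walk_arcs g k)"
    using awalk_walk_arcs[OF g g0] gk
    unfolding pre_digraph.cycle_def awalk_verts_with_proj_eq by auto
  then show False using T unfolding undirected_tree_def by blast
qed

text \<open>The only new triple is centred at the junction, and it exists only if both pieces are
  nonempty.\<close>

lemma reduced_join:
  assumes "reduced q m" "reduced p n" "q 0 = p 0" "0 < m \<Longrightarrow> 0 < n \<Longrightarrow> q 1 \<noteq> p 1"
  shows "reduced (join_walks q m p) (m + n)"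
  unfolding reduced_def
proof (intro allI impI)
  fix t assume t: "t + 2 \<le> m + n"
  consider "t + 2 \<le> m" | "t + 1 = m" | "m \<le> t" by linarith
  then show "join_walks q m p t \<noteq> join_walks q m p (t + 2)"
  proof cases
    case 1
    then have "q (m - (t + 2)) \<noteq> q (m - (t + 2) + 2)" using assms(1) by (auto simp: reduced_def)
    moreover have "m - (t + 2) + 2 = m - t" using 1 by simp
    ultimately show ?thesis using 1 by (simp add: join_walks_def)
  next
    case 2
    then show ?thesis using assms(4) t by (auto simp: join_walks_def)
  next
    case 3
    then have "p (t - m) \<noteq> p (t - m + 2)" using assms(2) t by (auto simp: reduced_def)
    moreover have "t - m + 2 = t + 2 - m" using 3 by simp
    ultimately show ?thesis using 3 assms(3) by (auto simp: join_walks_def)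
  qed
qed

text \<open>Induction on the competitor \<open>q\<close>: a backtrack is cut out, a common first
  step is cancelled, and otherwise gluing gives a closed reduced walk, which by injectivity has
  length 0.\<close>

lemma tree_reduced_walk_shortest:
  assumes T: "undirected_tree T"
    and "fun_walk T p n" "reduced p n" "fun_walk T q m" "p 0 = q 0" "p n = q m" "p 0 \<in> pverts T"
  shows "n \<le> m"
  using assms(2-)
proof (induction m arbitrary: p q n rule: less_induct)
  case (less m)
  have con: "connected_graph T" using T by (simp add: undirected_tree_def)
  show ?case
  proof (cases "reduced q m")
    case False
    then obtain t where t: "t + 2 \<le> m" "q t = q (t + 2)" by (auto simp: reduced_def)
    define q' where "q' = (\<lambda>s. if s \<le> t then q s else q (s + 2))"
    have "fun_walk T q' (m - 2)"
      unfolding fun_walk_def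
    proof (intro allI impI)
      fix s assume s: "s < m - 2"
      have "q' s = (if s < t then q s else q (s + 2))" using t by (auto simp: q'_def)
      moreover have "q' (Suc s) = (if s < t then q (Suc s) else q (Suc (s + 2)))"
        by (auto simp: q'_def)
      ultimately show "(q' s, q' (Suc s)) \<in> parcs T"
        using less.prems(3) s t(1) by (auto simp: fun_walk_def)
    qed
    moreover have "q' 0 = q 0" by (simp add: q'_def)
    moreover have "q' (m - 2) = q m"
    proof (cases "m - 2 \<le> t")
      case True
      then have "m - 2 = t" "m = t + 2" using t(1) by auto
      then show ?thesis using t(2) by (simp add: q'_def)
    next
      case False
      moreover have "m - 2 + 2 = m" using t(1) by simp
      ultimately show ?thesis by (simp only: q'_def if_False)
    qed
    ultimately have "n \<le> m - 2"
      using t(1) less.prems by (intro less.IH[where p=p and q=q']) simp_all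
    then show ?thesis by simp
  next
    case True
    show ?thesis
    proof (cases "0 < m \<and> 0 < n \<and> q 1 = p 1")
      case True
      have "(p 0, p 1) \<in> parcs T" using less.prems(1) True by (simp add: fun_walk_def)
      then have "p 1 \<in> pverts T" using connected_graph_arcs[OF con] by blast
      moreover have "fun_walk T (\<lambda>t. p (Suc t)) (n - 1)" "fun_walk T (\<lambda>t. q (Suc t)) (m - 1)"
        "reduced (\<lambda>t. p (Suc t)) (n - 1)"
        using less.prems unfolding fun_walk_def reduced_def by auto
      ultimately have "n - 1 \<le> m - 1"
        using less.prems True
        by (intro less.IH[where p="\<lambda>t. p (Suc t)" and q="\<lambda>t. q (Suc t)"]) simp_all
      then show ?thesis using True by linarith
    next
      case False
      let ?h = "join_walks q m p"
      have h: "fun_walk T ?h (m + n)" "reduced ?h (m + n)"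
        using fun_walk_join[OF con less.prems(3,1)] reduced_join[OF \<open>reduced q m\<close> less.prems(2)]
          less.prems False by auto
      have "?h 0 = ?h (m + n)" using less.prems by (auto simp: join_walks_def)
      moreover have "?h 0 \<in> pverts T"
        using fun_walk_in_verts[OF con less.prems(3), of m] less.prems by (simp add: join_walks_def)
      ultimately have "m + n = 0"
        using tree_reduced_walk_inj[OF T h] by (auto dest: inj_onD)
      then show ?thesis by simp
    qed
  qed
qed

lemma tree_graph_dist_reduced_walk:
  assumes T: "undirected_tree T" and p: "fun_walk T p n" "reduced p n" "p 0 \<in> pverts T"
  shows "graph_dist T (p 0) (p n) = n"
proof -
  have con: "connected_graph T" using T by (simp add: undirected_tree_def)
  have "p n \<in> pverts T" using fun_walk_in_verts[OF con p(1,3)] by simp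
  then obtain q where "q 0 = p 0" "q (graph_dist T (p 0) (p n)) = p n"
      "fun_walk T q (graph_dist T (p 0) (p n))"
    using graph_dist_walk[OF con p(3)] by blast
  then have "n \<le> graph_dist T (p 0) (p n)"
    using tree_reduced_walk_shortest[OF T p(1,2)] p(3) by metis
  then show ?thesis using graph_dist_le[OF p(1,3)] by simp
qed

section \<open>Rays in the homogeneous tree\<close>

text \<open>The recursion runs over arcs because the next vertex must avoid the previous one;
  infinite degree leaves a choice.\<close>

lemma infinite_degree_ray:
  assumes "connected_graph T" "\<And>v. v \<in> pverts T \<Longrightarrow> infinite {w. (v, w) \<in> parcs T}"
    and "(u, w) \<in> parcs T"
  shows "\<exists>R. R 0 = u \<and> R 1 = w \<and> (\<forall>n. fun_walk T R n \<and> reduced R n)"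
proof -
  have "\<exists>g. \<forall>n. (g n \<in> parcs T \<and> (n = 0 \<longrightarrow> g n = (u, w))) \<and>
      (fst (g (Suc n)) = snd (g n) \<and> snd (g (Suc n)) \<noteq> fst (g n))"
  proof (rule dependent_nat_choice)
    show "\<exists>e. e \<in> parcs T \<and> (0 = (0::nat) \<longrightarrow> e = (u, w))" using assms(3) by auto
  next
    fix e and n :: nat assume e: "e \<in> parcs T \<and> (n = 0 \<longrightarrow> e = (u, w))"
    then have "snd e \<in> pverts T" using connected_graph_arcs(4)[OF assms(1), of "fst e" "snd e"] by simp
    then have "infinite ({c. (snd e, c) \<in> parcs T} - {fst e})" using assms(2) by simp
    then obtain c where "c \<in> {c. (snd e, c) \<in> parcs T} - {fst e}"
      using infinite_imp_nonempty by blast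
    then show "\<exists>e'. (e' \<in> parcs T \<and> (Suc n = 0 \<longrightarrow> e' = (u, w))) \<and>
        fst e' = snd e \<and> snd e' \<noteq> fst e"
      by (intro exI[of _ "(snd e, c)"]) auto
  qed
  then obtain g where g: "\<And>n. g n \<in> parcs T" "g 0 = (u, w)"
      "\<And>n. fst (g (Suc n)) = snd (g n)" "\<And>n. snd (g (Suc n)) \<noteq> fst (g n)" by blast
  have "(fst (g t), fst (g (Suc t))) \<in> parcs T" for t using g(1)[of t] g(3)[of t] by simp
  moreover have "fst (g t) \<noteq> fst (g (t + 2))" for t using g(3)[of "Suc t"] g(4)[of t] by auto
  ultimately show ?thesis
    using g(2) g(3)[of 0] by (intro exI[of _ "\<lambda>n. fst (g n)"]) (auto simp: fun_walk_def reduced_def)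
qed

text \<open>Different rays leave the root by different neighbours, so joining them creates no
  backtrack and gives a geodesic.\<close>

lemma homogeneous_tree_star:
  fixes T :: "'b pair_pre_digraph"
  assumes "homogeneous_tree_inf T"
  obtains R :: "nat \<Rightarrow> nat \<Rightarrow> 'b" where "\<And>k i. R k i \<in> pverts T"
    "\<And>k l i j. k \<noteq> l \<Longrightarrow> graph_dist T (R k i) (R l j) = i + j"
proof -
  have T: "undirected_tree T" and inf: "\<And>v. v \<in> pverts T \<Longrightarrow> infinite {w. (v, w) \<in> parcs T}"
    using assms by (auto simp: homogeneous_tree_inf_def)
  have con: "connected_graph T" using T by (simp add: undirected_tree_def)
  then obtain u where u: "u \<in> pverts T"
    by (auto simp: connected_graph_def Digraph_Component.connected_def strongly_connected_def
        mk_symmetric_def)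
  obtain w :: "nat \<Rightarrow> 'b" where w: "inj w" "range w \<subseteq> {w. (u, w) \<in> parcs T}"
    using infinite_countable_subset[OF inf[OF u]] by blast
  have "\<forall>k. \<exists>R. R 0 = u \<and> R 1 = w k \<and> (\<forall>n. fun_walk T R n \<and> reduced R n)"
    using infinite_degree_ray[OF con inf] w(2) by blast
  then obtain R where R: "\<And>k. R k 0 = u" "\<And>k. R k 1 = w k"
      "\<And>k n. fun_walk T (R k) n" "\<And>k n. reduced (R k) n"
    by metis
  have verts: "R k i \<in> pverts T" for k i
    using fun_walk_in_verts[OF con R(3)[of k i]] R(1) u by simp
  have "graph_dist T (R k i) (R l j) = i + j" if "k \<noteq> l" for k l i j
  proof -
    let ?h = "join_walks (R k) i (R l)"
    have "fun_walk T ?h (i + j)" by (rule fun_walk_join[OF con R(3) R(3)]) (simp add: R)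
    moreover have "reduced ?h (i + j)"
    proof (rule reduced_join[OF R(4) R(4)])
      show "R k 1 \<noteq> R l 1" using w(1) that unfolding R(2) by (simp add: inj_eq)
    qed (simp add: R)
    moreover have "?h 0 = R k i" "?h (i + j) = R l j" using R(1) by (auto simp: join_walks_def)
    ultimately show ?thesis using tree_graph_dist_reduced_walk[OF T, of ?h "i + j"] verts by simp
  qed
  then show thesis using verts that by blast
qed

text \<open>
  The averages over \<open>N\<close> rays of the vertices at distances \<open>i\<close> and \<open>j\<close> from the root have inner
  product tending to \<open>\<phi> (i + j)\<close> as \<open>N\<close> grows, since pairs on a common ray carry vanishing weight.
\<close>

lemma homogeneous_tree_bounded_hankel_pd:
  fixes T :: "'b pair_pre_digraph"
  assumes T: "homogeneous_tree_inf T" and \<phi>: "\<phi> \<in> \<R>\<^sub>+ T"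
  shows "bounded_hankel_pd (\<lambda>n. Re (\<phi> n)) \<and> (\<forall>n. \<phi> n = of_real (Re (\<phi> n)))"
proof (rule homogeneous_tree_star[OF T])
  fix R :: "nat \<Rightarrow> nat \<Rightarrow> 'b"
  assume R: "\<And>k i. R k i \<in> pverts T"
      "\<And>k l i j. k \<noteq> l \<Longrightarrow> graph_dist T (R k i) (R l j) = i + j"
  have con: "connected_graph T" using T by (simp add: homogeneous_tree_inf_def undirected_tree_def)
  have self: "graph_dist T x x = 0" if "x \<in> pverts T" for x
    using graph_dist_eq_0[OF con that that] by simp
  have pdc: "positive_definite_on (pverts T) (\<lambda>x y. \<phi> (graph_dist T x y))"
    using \<phi> by (simp add: radial_pd_def)
  let ?r = "\<lambda>n. Re (\<phi> n)"
  have pd: "real_pd (pverts T) (\<lambda>x y. ?r (graph_dist T x y))"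
    using positive_definite_on_imp_real_pd[OF pdc] .
  have \<phi>0: "0 \<le> \<phi> 0"
    using pdc[unfolded positive_definite_on_def, rule_format, of 1 "\<lambda>_. R 0 0" "\<lambda>_. 1"] R self by simp
  \<comment> \<open>Two vertices at distance \<open>n\<close> with coefficients 1. They are taken on
    rays 0 and 1 since the distance formula needs different rays.\<close>
  have real: "\<phi> n = of_real (?r n)" for n
  proof -
    have "0 \<le> \<phi> 0 + \<phi> n + (\<phi> n + \<phi> 0)"
      using pdc[unfolded positive_definite_on_def, rule_format,
          of 2 "\<lambda>i. if i = 0 then R 0 0 else R 1 n" "\<lambda>_. 1"] R self
      by (simp add: numeral_2_eq_2)
    then show ?thesis using \<phi>0 by (simp add: less_eq_complex_def complex_eq_iff)
  qed
  have bound: "\<bar>?r n\<bar> \<le> ?r 0" for n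
  proof -
    have "0 \<le> ?r 0 + \<sigma> * ?r n + (\<sigma> * ?r n + \<sigma> * \<sigma> * ?r 0)" for \<sigma> :: real
      using pd[unfolded real_pd_def, rule_format,
          of 2 "\<lambda>i. if i = 0 then R 0 0 else R 1 n" "\<lambda>i. if i = 0 then 1 else \<sigma>"] R self
      by (simp add: numeral_2_eq_2 algebra_simps)
    from this[of 1] this[of "-1"] show ?thesis by simp
  qed
  have "real_pd UNIV (\<lambda>a b. ?r (a + b))"
    unfolding real_pd_def
  proof (intro allI impI)
    fix n :: nat and x :: "nat \<Rightarrow> nat" and c :: "nat \<Rightarrow> real"
    define Q where "Q = (\<Sum>i<n. \<Sum>j<n. ?r (x i + x j) * c i * c j)"
    define K where "K = (\<Sum>i<n. \<Sum>j<n. ?r 0 * \<bar>c i\<bar> * \<bar>c j\<bar>)"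
    define F where "F = (\<lambda>k l. \<Sum>i<n. \<Sum>j<n. ?r (graph_dist T (R k (x i)) (R l (x j))) * c i * c j)"
    have offdiag: "F k l = Q" if "k \<noteq> l" for k l using that R(2) by (simp add: F_def Q_def)
    have diag: "F k k \<le> K" for k
      unfolding F_def K_def
    proof (intro sum_mono)
      fix i j
      let ?t = "?r (graph_dist T (R k (x i)) (R k (x j))) * c i * c j"
      have "?t \<le> \<bar>?t\<bar>" by simp
      also have "\<dots> \<le> ?r 0 * \<bar>c i\<bar> * \<bar>c j\<bar>"
        unfolding abs_mult by (intro mult_right_mono bound) auto
      finally show "?t \<le> ?r 0 * \<bar>c i\<bar> * \<bar>c j\<bar>" .
    qed
    \<comment> \<open>With \<open>Suc N\<close> rays, each row of \<open>F\<close> has one diagonal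
      entry, at most \<open>K\<close>, and \<open>N\<close> entries \<open>Q\<close>; the positive
      factor \<open>Suc N\<close> cancels.\<close>
    have avg: "0 \<le> real N * Q + K" for N
    proof -
      let ?I = "{..<Suc N} \<times> {..<n}"
      have "0 \<le> (\<Sum>p\<in>?I. \<Sum>q\<in>?I. ?r (graph_dist T (R (fst p) (x (snd p))) (R (fst q) (x (snd q))))
          * c (snd p) * c (snd q))"
        by (rule real_pdD[OF pd, where x="\<lambda>p. R (fst p) (x (snd p))"]) (auto simp: R)
      also have "\<dots> = (\<Sum>k<Suc N. \<Sum>i<n. \<Sum>l<Suc N. \<Sum>j<n.
          ?r (graph_dist T (R k (x i)) (R l (x j))) * c i * c j)"
        unfolding sum.cartesian_product' by simp
      also have "\<dots> = (\<Sum>k<Suc N. \<Sum>l<Suc N. F k l)"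
        unfolding F_def by (intro sum.cong refl sum.swap)
      also have "\<dots> \<le> (\<Sum>k<Suc N. real N * Q + K)"
      proof (intro sum_mono)
        fix k assume k: "k \<in> {..<Suc N}"
        have "(\<Sum>l<Suc N. F k l) = F k k + (\<Sum>l\<in>{..<Suc N} - {k}. F k l)"
          using k by (intro sum.remove) auto
        also have "(\<Sum>l\<in>{..<Suc N} - {k}. F k l) = (\<Sum>l\<in>{..<Suc N} - {k}. Q)"
          by (intro sum.cong offdiag) auto
        also have "\<dots> = real N * Q" using k by (simp add: card_Diff_singleton)
        finally show "(\<Sum>l<Suc N. F k l) \<le> real N * Q + K" using diag[of k] by simp
      qed
      also have "\<dots> = real (Suc N) * (real N * Q + K)" by simp
      finally show ?thesis by (simp only: zero_le_mult_iff) auto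
    qed
    show "0 \<le> (\<Sum>i<n. \<Sum>j<n. ?r (x i + x j) * c i * c j)"
    proof (rule ccontr)
      assume "\<not> ?thesis"
      then have "Q < 0" by (simp add: Q_def)
      obtain N where "K < real N * (- Q)" using reals_Archimedean3[of "- Q"] \<open>Q < 0\<close> by auto
      then show False using avg[of N] by simp
    qed
  qed
  then show "bounded_hankel_pd ?r \<and> (\<forall>n. \<phi> n = of_real (?r n))"
    using bound by (intro conjI allI real) (auto simp: bounded_hankel_pd_def)
qed

section \<open>Transfer from the tree to the median graph through finite cubes\<close>

theorem proposition1p5:
  fixes T :: "'b pair_pre_digraph" and X :: "'a pair_pre_digraph"
  assumes "homogeneous_tree_inf T" and "median_graph X"
  shows "\<R>\<^sub>+ T \<subseteq> \<R>\<^sub>+ X"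
proof
  fix \<phi> assume "\<phi> \<in> \<R>\<^sub>+ T"
  define r where "r = (\<lambda>n. Re (\<phi> n))"
  note tree = homogeneous_tree_bounded_hankel_pd[OF assms(1) \<open>\<phi> \<in> \<R>\<^sub>+ T\<close>]
  have r: "bounded_hankel_pd r" unfolding r_def by (rule tree[THEN conjunct1])
  have \<phi>: "\<phi> n = of_real (r n)" for n unfolding r_def by (rule tree[THEN conjunct2, THEN spec])
  interpret median_metric "pverts X" "graph_dist X" by (rule median_graph_metric[OF assms(2)])
  have "real_pd (pverts X) (\<lambda>x y. r (graph_dist X x y))"
    unfolding real_pd_def
  proof (intro allI impI)
    fix n :: nat and x and c :: "nat \<Rightarrow> real" assume x: "\<forall>i<n. x i \<in> pverts X"
    \<comment> \<open>The base point \<open>x 0\<close> is a vertex as soon as the family is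
      nonempty; for \<open>n = 0\<close> all sums vanish.\<close>
    let ?A = "\<lambda>i. separators (x i) (x 0)"
    have "finite (\<Union>i<n. ?A i)" using card_separators x by auto
    then have "0 \<le> (\<Sum>i<n. \<Sum>j<n. r (card (sym_diff (?A i) (?A j))) * c i * c j)"
      by (rule real_pdD[OF real_pd_cube[OF _ r], where x="?A"]) auto
    also have "\<dots> = (\<Sum>i<n. \<Sum>j<n. r (graph_dist X (x i) (x j)) * c i * c j)"
      using x by (intro sum.cong refl) (simp add: card_sym_diff_separators)
    finally show "0 \<le> (\<Sum>i<n. \<Sum>j<n. r (graph_dist X (x i) (x j)) * c i * c j)" .
  qed
  then have "positive_definite_on (pverts X) (\<lambda>x y. \<phi> (graph_dist X x y))"
    unfolding \<phi> by (rule real_pd_imp_positive_definite_on) (simp add: d_sym)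
  then show "\<phi> \<in> \<R>\<^sub>+ X" by (simp add: radial_pd_def)
qed

end
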